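(* Let $\mathcal{G}$ be any subgroup of $GL_2(\mathbb{Z})$. Then $\mathcal{G}$ is a maximal abelian subgroup of $GL_2(\mathbb{Z})$ if and only if $\mathcal{G}=\mathcal{S}(Q)$ for some form $Q\in\mathcal{F}_+\cup\mathcal{F}_-$.
   Context: Here a form is $Q(x,y)=ax^2+bxy+cy^2$ with $a,b,c$ coprime integers (not necessarily irreducible or indefinite), identified with the matrix $Q=\begin{pmatrix}a&b/2\\ b/2&c\end{pmatrix}$; its discriminant is $b^2-4ac$. $\mathcal{S}(Q)=\{M\in GL_2(\mathbb{Z}):\det(M)M^{T}QM=Q\}$. $\mathcal{F}_+$ is the set of forms that are indefinite and irreducible over $\mathbb{Q}$; $\mathcal{F}_-$ is the set of forms whose discriminant lies in $\{-4,-3,0,1,4\}$. *)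

theory Defs
  imports
    "HOL-Analysis.Analysis"
    "HOL-Computational_Algebra.Polynomial_Factorial"
    "HOL-Algebra.Group"
begin

definition GL2Z :: "(int^2^2) monoid" where
  "GL2Z = \<lparr>carrier = {M. invertible M}, mult = (**), one = mat 1\<rparr>"

lemma group_GL2Z: "group GL2Z"
proof (rule groupI)
  fix M assume "M \<in> carrier GL2Z"
  then obtain N where "M ** N = mat 1" "N ** M = mat 1"
    unfolding GL2Z_def invertible_def by auto
  then have "N \<in> carrier GL2Z" "N \<otimes>\<^bsub>GL2Z\<^esub> M = \<one>\<^bsub>GL2Z\<^esub>"
    unfolding GL2Z_def invertible_def by auto
  then show "\<exists>N\<in>carrier GL2Z. N \<otimes>\<^bsub>GL2Z\<^esub> M = \<one>\<^bsub>GL2Z\<^esub>" by blast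
qed (auto simp: GL2Z_def invertible_mult matrix_mul_assoc
       intro!: exI[of _ "mat 1"] simp: invertible_def[of "mat 1"])

definition maximal_abelian_subgroup :: "'a set \<Rightarrow> ('a, 'b) monoid_scheme \<Rightarrow> bool" where
  "maximal_abelian_subgroup H G \<longleftrightarrow>
     subgroup H G \<and> comm_group (G\<lparr>carrier := H\<rparr>) \<and>
     (\<forall>K. subgroup K G \<and> comm_group (G\<lparr>carrier := K\<rparr>) \<and> H \<subseteq> K \<longrightarrow> K = H)"

text \<open>The triple \<open>(a, b, c)\<close> stands for \<open>a x\<^sup>2 + b x y + c y\<^sup>2\<close>; coprimality of the
  coefficients is joint, not pairwise.\<close>

definition forms :: "(int \<times> int \<times> int) set" where
  "forms = {(a, b, c). gcd a (gcd b c) = 1}"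

fun form_eval :: "int \<times> int \<times> int \<Rightarrow> real \<Rightarrow> real \<Rightarrow> real" where
  "form_eval (a, b, c) x y =
     of_int a * x\<^sup>2 + of_int b * x * y + of_int c * y\<^sup>2"

fun form_matrix :: "int \<times> int \<times> int \<Rightarrow> real^2^2" where
  "form_matrix (a, b, c) =
     vector [vector [of_int a, of_int b / 2],
             vector [of_int b / 2, of_int c]]"

fun form_discr :: "int \<times> int \<times> int \<Rightarrow> int" where
  "form_discr (a, b, c) = b\<^sup>2 - 4 * a * c"

text \<open>The form as an element of \<open>\<rat>[y][x]\<close>: the outer variable is \<open>x\<close>, the inner one \<open>y\<close>.\<close>

fun form_poly :: "int \<times> int \<times> int \<Rightarrow> rat poly poly" where
  "form_poly (a, b, c) = [: [:0, 0, of_int c:], [:0, of_int b:], [:of_int a:] :]"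

lemma form_matrix_eval:
  "vector [x, y] \<bullet> (form_matrix Q *v vector [x, y]) = form_eval Q x y"
  by (cases Q) (simp add: inner_vec_def matrix_vector_mult_def sum_2 power2_eq_square
      algebra_simps)

lemma form_poly_eval:
  "poly (poly (form_poly (a, b, c)) [:x:]) y =
     of_int a * x\<^sup>2 + of_int b * x * y + of_int c * y\<^sup>2"
  by (simp add: power2_eq_square algebra_simps)

definition indefinite_form :: "int \<times> int \<times> int \<Rightarrow> bool" where
  "indefinite_form Q \<longleftrightarrow> (\<exists>x y. form_eval Q x y > 0) \<and> (\<exists>x y. form_eval Q x y < 0)"

definition S_group :: "int \<times> int \<times> int \<Rightarrow> (int^2^2) set" where
  "S_group Q = {M \<in> carrier GL2Z.
     real_of_int (det M) *\<^sub>R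
       (transpose (map_matrix real_of_int M) ** form_matrix Q ** map_matrix real_of_int M)
     = form_matrix Q}"

definition F_plus :: "(int \<times> int \<times> int) set" where
  "F_plus = {Q \<in> forms. indefinite_form Q \<and> irreducible (form_poly Q)}"

definition F_minus :: "(int \<times> int \<times> int) set" where
  "F_minus = {Q \<in> forms. form_discr Q \<in> {-4, -3, 0, 1, 4}}"

end

theory Submission
  imports Defs "HOL-Computational_Algebra.Nth_Powers"
begin

text \<open>
  Attach to a matrix \<open>M\<close> the form \<open>M\<^sub>2\<^sub>1 x\<^sup>2 + (M\<^sub>2\<^sub>2 - M\<^sub>1\<^sub>1) x y - M\<^sub>1\<^sub>2 y\<^sup>2\<close>. Two matrices commute iff
  their forms are proportional. Write \<open>Q = J (A - b / 2)\<close> with \<open>J\<close> skew-symmetric and \<open>A\<close> a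
  matrix with form \<open>Q\<close>; since \<open>M\<^sup>T J M = det(M) J\<close>, the condition \<open>det(M) M\<^sup>T Q M = Q\<close> says that
  \<open>M\<close> commutes with \<open>A\<close>, so \<open>\<S>(Q)\<close> consists of the units whose form is an integral multiple
  \<open>t Q\<close>. Hence \<open>\<S>(Q)\<close> is abelian, every abelian subgroup lies in some \<open>\<S>(Q)\<close>, and \<open>\<S>(Q)\<close> is
  maximal as soon as it contains a non-scalar matrix. A matrix with form \<open>t Q\<close> and trace \<open>u\<close> has
  determinant \<open>(u\<^sup>2 - D t\<^sup>2) / 4\<close>, where \<open>D\<close> is the discriminant of \<open>Q\<close>, so the question is for
  which \<open>D\<close> the equation \<open>u\<^sup>2 - D t\<^sup>2 = \<plusminus>4\<close> has a solution with \<open>t \<noteq> 0\<close>: for every positive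
  non-square by Pell's equation, and otherwise only for \<open>-4, -3, 0, 1, 4\<close>.
\<close>

section \<open>Pell's equation\<close>

lemma is_square_if_rational_square:
  fixes x :: "'a::field_char_0"
  assumes "x \<in> \<rat>" "x\<^sup>2 = of_int D"
  shows "is_square D"
proof -
  obtain p q where q: "q > 0" and x: "x = of_int p / of_int q"
    using assms(1) by (rule Rats_cases')
  then have "of_int p = x * of_int q" by simp
  then have "(of_int (p\<^sup>2) :: 'a) = of_int (D * q\<^sup>2)"
    by (simp add: power_mult_distrib assms(2))
  then have p: "p\<^sup>2 = D * q\<^sup>2" by (simp only: of_int_eq_iff)
  then have "q\<^sup>2 dvd p\<^sup>2" by simp
  then have "q dvd p" by simp
  then obtain k where "p = q * k" ..
  with p q have "D = k\<^sup>2" by (simp add: power_mult_distrib)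
  then show ?thesis ..
qed

lemma approx_set_norm_bound:
  assumes "(h, k) \<in> approx_set \<theta>"
  shows "\<bar>(of_int h)\<^sup>2 - \<theta>\<^sup>2 * (of_int k)\<^sup>2\<bar> \<le> 1 + 2 * \<bar>\<theta>\<bar>"
proof -
  have k_ge_1: "real_of_int k \<ge> 1" and approx: "\<bar>\<theta> - of_int h / of_int k\<bar> < 1 / (of_int k)\<^sup>2"
    using assms by (auto simp: approx_set_def)
  define e where "e = of_int h - of_int k * \<theta>"
  have "\<bar>e\<bar> * of_int k = (of_int k)\<^sup>2 * \<bar>\<theta> - of_int h / of_int k\<bar>"
    using k_ge_1 by (simp add: e_def abs_if field_simps power2_eq_square)
  also have "\<dots> \<le> 1"
    using mult_left_mono[OF less_imp_le[OF approx], of "(of_int k)\<^sup>2"] k_ge_1 by simp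
  finally have e_k_le_1: "\<bar>e\<bar> * of_int k \<le> 1" .
  then have e_le_1: "\<bar>e\<bar> \<le> 1" using mult_left_mono[OF k_ge_1, of "\<bar>e\<bar>"] by simp
  have "(of_int h)\<^sup>2 - \<theta>\<^sup>2 * (of_int k)\<^sup>2 = e * e + 2 * \<theta> * (e * of_int k)"
    by (simp add: e_def power2_eq_square algebra_simps)
  also have "\<bar>\<dots>\<bar> \<le> \<bar>e\<bar> * \<bar>e\<bar> + 2 * \<bar>\<theta>\<bar> * (\<bar>e\<bar> * of_int k)"
    using k_ge_1 by (simp add: abs_mult order.trans[OF abs_triangle_ineq])
  also have "\<dots> \<le> 1 * 1 + 2 * \<bar>\<theta>\<bar> * 1"
    using e_le_1 e_k_le_1 k_ge_1 by (intro add_mono mult_mono) auto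
  finally show ?thesis by simp
qed

text \<open>The witness is \<open>(x + y \<surd>D) / (z + w \<surd>D)\<close>, which the congruences make integral.\<close>

lemma pell_solution_of_congruent_pair:
  fixes D m :: int
  assumes nonzero: "m \<noteq> 0" and norms: "x\<^sup>2 - D * y\<^sup>2 = m" "z\<^sup>2 - D * w\<^sup>2 = m"
    and cong: "m dvd x - z" "m dvd y - w" and independent: "x * w \<noteq> y * z"
  shows "\<exists>u t. t \<noteq> 0 \<and> u\<^sup>2 - D * t\<^sup>2 = 1"
proof -
  obtain i j where ij: "x = z + m * i" "y = w + m * j"
    using cong by (metis add.commute diff_eq_eq dvdE)
  define u t where "u = 1 + i * z - D * j * w" and "t = i * w - j * z"
  have u: "x * z - D * y * w = m * u" using ij norms(2) unfolding u_def by algebra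
  have t: "x * w - y * z = m * t" using ij unfolding t_def by algebra
  have "m\<^sup>2 * (u\<^sup>2 - D * t\<^sup>2) = (x\<^sup>2 - D * y\<^sup>2) * (z\<^sup>2 - D * w\<^sup>2)" using u t by algebra
  then have "m\<^sup>2 * (u\<^sup>2 - D * t\<^sup>2) = m\<^sup>2 * 1" unfolding norms by (simp add: power2_eq_square)
  then have "u\<^sup>2 - D * t\<^sup>2 = 1" using nonzero by simp
  moreover have "t \<noteq> 0" using t independent by auto
  ultimately show ?thesis by blast
qed

definition norm_residues :: "int \<Rightarrow> int \<times> int \<Rightarrow> int \<times> int \<times> int" where
  "norm_residues D = (\<lambda>(h, k). let m = h\<^sup>2 - D * k\<^sup>2 in (m, h mod m, k mod m))"

lemma norm_nonzero_if_nonsquare: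
  fixes h k D :: int
  assumes "\<not> is_square D" "k \<noteq> 0"
  shows "h\<^sup>2 - D * k\<^sup>2 \<noteq> 0"
proof
  assume "h\<^sup>2 - D * k\<^sup>2 = 0"
  then have "rat_of_int (h\<^sup>2) = of_int (D * k\<^sup>2)" by simp
  then have "(rat_of_int h / of_int k)\<^sup>2 = of_int D"
    using assms(2) by (simp add: power_divide field_simps)
  then show False
    using assms(1) is_square_if_rational_square[of "rat_of_int h / of_int k" D] by simp
qed

lemma finite_norm_residues_image_approx_set:
  assumes "D \<ge> 0" and nonsquare: "\<not> is_square D"
  shows "finite (norm_residues D ` approx_set (sqrt (of_int D)))"
proof (rule finite_subset)
  define B where "B = \<lfloor>1 + 2 * sqrt (of_int D)\<rfloor>"
  have "norm_residues D (h, k) \<in> {-B..B} \<times> {-B..B} \<times> {-B..B}"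
    if hk: "(h, k) \<in> approx_set (sqrt (of_int D))" for h k
  proof -
    define m where "m = h\<^sup>2 - D * k\<^sup>2"
    have "m \<noteq> 0"
      using norm_nonzero_if_nonsquare[OF nonsquare] hk by (auto simp: m_def approx_set_def)
    have "real_of_int \<bar>m\<bar> \<le> 1 + 2 * sqrt (of_int D)"
      using approx_set_norm_bound[OF hk] assms(1) by (simp add: m_def)
    then have "\<bar>m\<bar> \<le> B" by (simp only: B_def le_floor_iff)
    moreover have "\<bar>h mod m\<bar> < \<bar>m\<bar>" "\<bar>k mod m\<bar> < \<bar>m\<bar>"
      using \<open>m \<noteq> 0\<close> by (simp_all add: abs_mod_less)
    moreover have "norm_residues D (h, k) = (m, h mod m, k mod m)"
      by (simp add: norm_residues_def m_def Let_def)
    ultimately show ?thesis by auto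
  qed
  then show "norm_residues D ` approx_set (sqrt (of_int D)) \<subseteq> {-B..B} \<times> {-B..B} \<times> {-B..B}"
    by (intro image_subsetI) (simp only: split_paired_all)
qed simp

theorem pell_nontrivial_solution:
  fixes D :: int
  assumes "D \<ge> 0" and nonsquare: "\<not> is_square D"
  shows "\<exists>u t. t \<noteq> 0 \<and> u\<^sup>2 - D * t\<^sup>2 = 1"
proof -
  let ?A = "approx_set (sqrt (of_int D))"
  have "sqrt (of_int D) \<notin> \<rat>"
    using is_square_if_rational_square[of "sqrt (of_int D)" D] assms by auto
  then have "infinite ?A" by (simp add: rational_iff_finite_approx_set)
  then have "\<not> inj_on (norm_residues D) ?A"
    using finite_norm_residues_image_approx_set[OF assms] finite_imageD by blast
  then obtain x y z w where xy: "(x, y) \<in> ?A" and zw: "(z, w) \<in> ?A"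
    and distinct: "(x, y) \<noteq> (z, w)"
    and collision: "norm_residues D (x, y) = norm_residues D (z, w)"
    unfolding inj_on_def by fast
  have independent: "x * w \<noteq> y * z"
  proof
    assume dependent: "x * w = y * z"
    then have "\<bar>x\<bar> * \<bar>w\<bar> = \<bar>z\<bar> * \<bar>y\<bar>" by (metis abs_mult mult.commute)
    with xy zw have "y = w"
      using coprime_crossproduct_int[of x y z w] by (auto simp: approx_set_def)
    with dependent zw distinct show False by (auto simp: approx_set_def)
  qed
  define m where "m = x\<^sup>2 - D * y\<^sup>2"
  have "m \<noteq> 0"
    using norm_nonzero_if_nonsquare[OF nonsquare] xy by (auto simp: m_def approx_set_def)
  moreover have "x\<^sup>2 - D * y\<^sup>2 = m" by (simp add: m_def)
  moreover have "z\<^sup>2 - D * w\<^sup>2 = m" "m dvd x - z" "m dvd y - w"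
    using collision by (auto simp: norm_residues_def m_def Let_def mod_eq_dvd_iff)
  ultimately show ?thesis
    using independent by (rule pell_solution_of_congruent_pair)
qed

definition pell_four_nontrivial :: "int \<Rightarrow> bool" where
  "pell_four_nontrivial D \<longleftrightarrow> (\<exists>u t. t \<noteq> 0 \<and> \<bar>u\<^sup>2 - D * t\<^sup>2\<bar> = 4)"

lemma pell_four_nontrivial_if_pos_nonsquare:
  assumes "D > 0" "\<not> is_square D"
  shows "pell_four_nontrivial D"
proof -
  obtain u t where t: "t \<noteq> 0" and ut: "u\<^sup>2 - D * t\<^sup>2 = 1"
    using pell_nontrivial_solution[of D] assms by auto
  have "(2 * u)\<^sup>2 - D * (2 * t)\<^sup>2 = 4" using ut by algebra
  moreover have "2 * t \<noteq> 0" using t by simp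
  ultimately show ?thesis unfolding pell_four_nontrivial_def by (metis abs_numeral)
qed

lemma pell_four_nontrivial_lower_bound:
  assumes "pell_four_nontrivial D"
  shows "D \<ge> -4"
proof (cases "D < 0")
  case True
  obtain u t where "t \<noteq> 0" and ut: "\<bar>u\<^sup>2 - D * t\<^sup>2\<bar> = 4"
    using assms by (auto simp: pell_four_nontrivial_def)
  then have "t\<^sup>2 \<ge> 1" by (simp add: int_one_le_iff_zero_less)
  with True have "D * t\<^sup>2 \<le> D" by simp
  with ut zero_le_power2[of u] show ?thesis by linarith
qed simp

lemma squares_at_distance_four:
  fixes x u :: int
  assumes "\<bar>u\<^sup>2 - x\<^sup>2\<bar> = 4" "x \<noteq> 0"
  shows "\<bar>x\<bar> = 2"
proof -
  define v y where "v = \<bar>u\<bar>" and "y = \<bar>x\<bar>"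
  have "v \<ge> 0" "y > 0" using assms(2) by (simp_all add: v_def y_def)
  have vy: "\<bar>v * v - y * y\<bar> = 4" using assms(1) by (simp add: v_def y_def power2_eq_square)
  also have "v * v - y * y = (v - y) * (v + y)" by (simp add: algebra_simps)
  finally have "\<bar>v - y\<bar> * \<bar>v + y\<bar> = 4" by (simp add: abs_mult)
  then have "v + y dvd 4" by (metis abs_dvd_iff dvd_triv_right)
  then have "v + y \<le> 4" by (simp add: zdvd_imp_le)
  with \<open>v \<ge> 0\<close> \<open>y > 0\<close> have "y \<in> {1, 2, 3, 4}" "v \<in> {0, 1, 2, 3}" by auto
  with vy show ?thesis unfolding y_def[symmetric] by auto
qed

lemma pell_four_nontrivial_square:
  assumes "pell_four_nontrivial (d\<^sup>2)"
  shows "d\<^sup>2 \<in> {0, 1, 4}"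
proof (cases "d = 0")
  case False
  obtain u t where "t \<noteq> 0" "\<bar>u\<^sup>2 - (d * t)\<^sup>2\<bar> = 4"
    using assms by (auto simp: pell_four_nontrivial_def power_mult_distrib)
  then have "\<bar>d * t\<bar> = 2" using False squares_at_distance_four by simp
  then have "\<bar>d\<bar> dvd 2" by (metis abs_mult dvd_triv_left)
  then have "\<bar>d\<bar> \<le> 2" by (simp add: zdvd_imp_le)
  with False have "d \<in> {-2, -1, 1, 2}" by auto
  then show ?thesis by auto
qed simp

theorem pell_four_nontrivial_iff:
  assumes "D mod 4 \<in> {0, 1}"
  shows "pell_four_nontrivial D \<longleftrightarrow> D \<in> {-4, -3, 0, 1, 4} \<or> D > 0 \<and> \<not> is_square D"
proof
  assume pell: "pell_four_nontrivial D"
  consider "D < 0" | "is_square D" | "D > 0" "\<not> is_square D" by fastforce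
  then show "D \<in> {-4, -3, 0, 1, 4} \<or> D > 0 \<and> \<not> is_square D"
  proof cases
    assume "D < 0"
    with pell_four_nontrivial_lower_bound[OF pell] have "D \<in> {-4, -3, -2, -1}" by auto
    with assms show ?thesis by auto
  next
    assume "is_square D"
    then obtain d where "D = d\<^sup>2" by (rule is_nth_powerE)
    with pell show ?thesis using pell_four_nontrivial_square[of d] by simp
  qed simp
next
  have witness: "pell_four_nontrivial D" if "\<bar>u\<^sup>2 - D * t\<^sup>2\<bar> = 4" "t \<noteq> 0" for u t
    using that by (auto simp: pell_four_nontrivial_def)
  assume "D \<in> {-4, -3, 0, 1, 4} \<or> D > 0 \<and> \<not> is_square D"
  then consider "D \<in> {-4, 4}" | "D = -3" | "D = 0" | "D = 1" | "D > 0" "\<not> is_square D" by auto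
  then show "pell_four_nontrivial D"
    using witness[of 0 1] witness[of 1 1] witness[of 2 1] witness[of 0 2]
      pell_four_nontrivial_if_pos_nonsquare
    by cases auto
qed

section \<open>Irreducible and indefinite forms\<close>

lemma irreducible_quadratic_if_no_root:
  fixes p :: "'a::idom poly"
  assumes deg: "degree p = 2" and lead: "lead_coeff p dvd 1" and no_root: "\<And>x. poly p x \<noteq> 0"
  shows "irreducible p"
proof (rule irreducibleI)
  show "p \<noteq> 0" using deg by auto
  show "\<not> p dvd 1" using deg by (auto simp: is_unit_poly_iff)
  fix f g assume fg: "p = f * g"
  have lead_units: "lead_coeff f dvd 1" "lead_coeff g dvd 1"
    using lead unfolding fg lead_coeff_mult by (auto dest: dvd_mult_left dvd_mult_right)
  have unit: "h dvd 1" if "degree h = 0" "lead_coeff h dvd 1" for h :: "'a poly"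
    using that by (auto elim!: degree_eq_zeroE simp: is_unit_const_poly_iff)
  have "degree h \<noteq> 1" if h: "h dvd p" and lead_h: "lead_coeff h dvd 1" for h
  proof
    assume "degree h = 1"
    then obtain h0 h1 where "h = [:h0, h1:]" "h1 \<noteq> 0" by (rule degree1_coeffs)
    moreover obtain k where "1 = lead_coeff h * k" using lead_h ..
    ultimately have "poly h (- (h0 * k)) = 0" by (simp add: mult.assoc mult.commute[of k])
    with h no_root show False by (metis dvdE mult_zero_left poly_mult)
  qed
  then have "degree f \<noteq> 1" using fg lead_units by simp
  moreover have "degree f + degree g = 2"
    using deg \<open>p \<noteq> 0\<close> unfolding fg by (simp add: degree_mult_eq)
  ultimately consider "degree f = 0" | "degree g = 0" by linarith
  then show "f dvd 1 \<or> g dvd 1" using unit lead_units by cases auto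
qed

lemma irreducible_form_poly_if_discr_nonsquare:
  assumes nonsquare: "\<not> is_square (form_discr Q)"
  shows "irreducible (form_poly Q)"
proof -
  obtain a b c where Q: "Q = (a, b, c)" by (cases Q)
  have a_nonzero: "a \<noteq> 0" using nonsquare by (auto simp: Q)
  have "poly (form_poly Q) r \<noteq> 0" for r
  proof
    assume "poly (form_poly Q) r = 0"
    then have "poly (poly (form_poly Q) r) 1 = 0" by simp
    then have "of_int a * (poly r 1)\<^sup>2 + of_int b * poly r 1 + of_int c = 0"
      by (simp add: Q power2_eq_square algebra_simps)
    then have "(2 * of_int a * poly r 1 + of_int b)\<^sup>2 = of_int (form_discr Q)"
      by (simp add: Q) algebra
    moreover have "2 * of_int a * poly r 1 + of_int b \<in> \<rat>"
      using Rats_of_rat[of "2 * of_int a * poly r 1 + of_int b", where ?'a = rat] by simp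
    ultimately show False using nonsquare is_square_if_rational_square by blast
  qed
  then show ?thesis
    using a_nonzero
    by (intro irreducible_quadratic_if_no_root) (auto simp: Q is_unit_poly_iff dvd_field_iff)
qed

lemma linear_form_not_unit: "\<not> [:[:0, \<beta>:], [:\<alpha>:]:] dvd (1 :: 'a::idom poly poly)"
  by (auto simp: is_unit_poly_iff)

lemma form_poly_reducible_if_discr_square:
  assumes "is_square (form_discr Q)"
  shows "\<not> irreducible (form_poly Q)"
proof -
  obtain a b c where Q: "Q = (a, b, c)" by (cases Q)
  obtain d where d: "b\<^sup>2 - 4 * a * c = d\<^sup>2" using assms by (auto simp: Q elim: is_nth_powerE)
  have "\<exists>\<alpha> \<beta> \<gamma> \<delta>. form_poly Q = [:[:0, \<beta>:], [:\<alpha>:]:] * [:[:0, \<delta>:], [:\<gamma>:]:]"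
  proof (cases "a = 0")
    case True
    then have "form_poly Q = [:[:0, 1:], [:0:]:] * [:[:0, of_int c:], [:of_int b:]:]"
      by (simp add: Q)
    then show ?thesis by blast
  next
    case False
    define r s where "r = (of_int b - of_int d) / (2 * rat_of_int a)"
      and "s = (of_int b + of_int d) / (2 * rat_of_int a)"
    have sum: "of_int a * (r + s) = of_int b" using False by (simp add: r_def s_def field_simps)
    have "rat_of_int (b\<^sup>2 - 4 * a * c) = of_int (d\<^sup>2)" using d by simp
    then have "(of_int b - of_int d) * (of_int b + of_int d) = 4 * rat_of_int a * of_int c"
      by (simp add: power2_eq_square algebra_simps)
    then have prod: "of_int a * (r * s) = of_int c" using False by (simp add: r_def s_def)
    have "form_poly Q = [:[:0, of_int a * r:], [:of_int a:]:] * [:[:0, s:], [:1:]:]"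
      using sum prod by (simp add: Q algebra_simps)
    then show ?thesis by blast
  qed
  then show ?thesis using linear_form_not_unit irreducibleD by metis
qed

lemma indefinite_form_iff_mult_neg:
  "indefinite_form Q \<longleftrightarrow> (\<exists>x y z w. form_eval Q x y * form_eval Q z w < 0)"
  unfolding indefinite_form_def by (auto simp: mult_less_0_iff)

lemma indefinite_form_iff_discr_pos: "indefinite_form Q \<longleftrightarrow> form_discr Q > 0"
proof -
  obtain a b c where Q: "Q = (a, b, c)" by (cases Q)
  let ?D = "real_of_int (form_discr Q)"
  have "indefinite_form Q" if D: "?D > 0"
  proof (cases "a = 0")
    case False
    have "form_eval Q 1 0 * form_eval Q (- of_int b) (2 * of_int a) = - ((of_int a)\<^sup>2 * ?D)"
      by (simp add: Q power2_eq_square algebra_simps)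
    also have "\<dots> < 0" using D False by simp
    finally show ?thesis unfolding indefinite_form_iff_mult_neg by blast
  next
    case True
    with D have "form_eval Q ((1 - of_int c) / of_int b) 1 *
        form_eval Q ((- 1 - of_int c) / of_int b) 1 = - 1"
      by (simp add: Q)
    then show ?thesis
      unfolding indefinite_form_iff_mult_neg by (metis neg_less_0_iff_less zero_less_one)
  qed
  moreover have "?D > 0" if indefinite: "indefinite_form Q"
  proof (rule ccontr)
    assume "\<not> ?D > 0"
    obtain x y z w where neg: "form_eval Q x y * form_eval Q z w < 0"
      using indefinite unfolding indefinite_form_iff_mult_neg by blast
    have "4 * (form_eval Q x y * form_eval Q z w) =
        (2 * of_int a * x * z + of_int b * (x * w + y * z) + 2 * of_int c * y * w)\<^sup>2
          - ?D * (x * w - y * z)\<^sup>2"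
      by (simp add: Q) algebra
    moreover have "?D * (x * w - y * z)\<^sup>2 \<le> 0"
      using \<open>\<not> ?D > 0\<close> by (intro mult_nonpos_nonneg) auto
    ultimately show False using neg by (smt (verit) zero_le_power2)
  qed
  ultimately show ?thesis by auto
qed

lemma F_plus_iff: "Q \<in> F_plus \<longleftrightarrow> Q \<in> forms \<and> form_discr Q > 0 \<and> \<not> is_square (form_discr Q)"
  unfolding F_plus_def indefinite_form_iff_discr_pos
  using irreducible_form_poly_if_discr_nonsquare[of Q] form_poly_reducible_if_discr_square[of Q]
  by simp blast

lemma form_discr_mod_4: "form_discr Q mod 4 \<in> {0, 1}"
proof -
  obtain a b c where Q: "Q = (a, b, c)" by (cases Q)
  have "form_discr Q = b\<^sup>2 - 4 * (a * c)" by (simp add: Q)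
  then have "form_discr Q mod 4 = (b mod 4)\<^sup>2 mod 4"
    by (simp add: power_mod mod_diff_right_eq[symmetric, of _ "4 * (a * c)"])
  moreover have "b mod 4 \<in> {0, 1, 2, 3}" by auto
  ultimately show ?thesis by auto
qed

lemma F_plus_Un_F_minus_iff:
  "Q \<in> F_plus \<union> F_minus \<longleftrightarrow> Q \<in> forms \<and> pell_four_nontrivial (form_discr Q)"
  unfolding pell_four_nontrivial_iff[OF form_discr_mod_4] by (auto simp: F_plus_iff F_minus_def)

section \<open>Proportional forms\<close>

lemma zero_notin_forms [simp]: "(0, 0, 0) \<notin> forms"
  by (simp add: forms_def)

fun scale_form :: "'a::times \<Rightarrow> 'a \<times> 'a \<times> 'a \<Rightarrow> 'a \<times> 'a \<times> 'a" where
  "scale_form t (a, b, c) = (t * a, t * b, t * c)"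

fun proportional :: "'a::times \<times> 'a \<times> 'a \<Rightarrow> 'a \<times> 'a \<times> 'a \<Rightarrow> bool" where
  "proportional (a, b, c) (x, y, z) \<longleftrightarrow> a * y = b * x \<and> a * z = c * x \<and> b * z = c * y"

lemma form_discr_scale_form: "form_discr (scale_form t Q) = form_discr Q * t\<^sup>2"
  by (cases Q) (simp add: power2_eq_square algebra_simps)

lemma proportional_sym:
  fixes P Q :: "'a::comm_semiring \<times> 'a \<times> 'a"
  shows "proportional P Q \<Longrightarrow> proportional Q P"
  by (cases P; cases Q) (auto simp: mult.commute)

lemma proportional_scale_form: "proportional (scale_form t Q) Q" for t :: "'a::comm_semiring"
  by (cases Q) (simp add: mult_ac)

lemma proportional_trans:
  fixes P Q R :: "'a::idom \<times> 'a \<times> 'a"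
  assumes "proportional P Q" "proportional Q R" "Q \<noteq> (0, 0, 0)"
  shows "proportional P R"
proof -
  obtain x y z a b c u v w where PQR: "P = (x, y, z)" "Q = (a, b, c)" "R = (u, v, w)"
    by (cases P; cases Q; cases R)
  have PQ: "x * b = y * a" "x * c = z * a" "y * c = z * b"
    and QR: "a * v = b * u" "a * w = c * u" "b * w = c * v"
    using assms(1,2) by (simp_all add: PQR)
  have "q\<^sup>2 * (x * v) = q\<^sup>2 * (y * u) \<and> q\<^sup>2 * (x * w) = q\<^sup>2 * (z * u) \<and> q\<^sup>2 * (y * w) = q\<^sup>2 * (z * v)"
    if q: "q \<in> {a, b, c}" for q
  proof -
    consider "q = a" | "q = b" | "q = c" using q by blast
    then show ?thesis using PQ QR by cases (intro conjI; algebra)+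
  qed
  moreover obtain q where "q \<in> {a, b, c}" "q \<noteq> 0" using assms(3) PQR by auto
  ultimately show ?thesis by (auto simp: PQR)
qed

lemma proportional_to_primitive:
  assumes "Q \<in> forms" "proportional P Q"
  obtains t where "P = scale_form t Q"
proof -
  obtain a b c x y z where PQ: "Q = (a, b, c)" "P = (x, y, z)" by (cases P; cases Q)
  obtain r s where "r * b + s * c = gcd b c" using bezout_int by blast
  moreover obtain k l where "k * a + l * gcd b c = gcd a (gcd b c)" using bezout_int by blast
  ultimately have "k * a + l * (r * b + s * c) = 1" using assms(1) by (simp add: PQ forms_def)
  moreover have "x * b = y * a" "x * c = z * a" "y * c = z * b"
    using assms(2) by (simp_all add: PQ)
  ultimately have "x = (k * x + l * (r * y + s * z)) * a" "y = (k * x + l * (r * y + s * z)) * b"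
      "z = (k * x + l * (r * y + s * z)) * c"
    by algebra+
  then have "P = scale_form (k * x + l * (r * y + s * z)) Q" by (simp add: PQ)
  then show thesis by (rule that)
qed

lemma primitive_multiple:
  assumes "P \<noteq> (0, 0, 0)"
  obtains t Q where "Q \<in> forms" "P = scale_form t Q"
proof -
  obtain x y z where P: "P = (x, y, z)" by (cases P)
  define t where "t = gcd x (gcd y z)"
  have "t > 0" using assms by (auto simp: t_def P)
  have "t dvd x" "t dvd y" "t dvd z" by (auto simp: t_def intro: dvd_trans)
  then obtain a b c where abc: "x = t * a" "y = t * b" "z = t * c" by (metis dvdE)
  have "t * gcd a (gcd b c) = gcd x (gcd y z)"
    using \<open>t > 0\<close> gcd_mult_distrib_int[of t a "gcd b c"] gcd_mult_distrib_int[of t b c]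
    by (simp add: abc)
  then have "gcd a (gcd b c) = 1" using \<open>t > 0\<close> by (simp add: t_def[symmetric])
  then have "(a, b, c) \<in> forms" by (simp add: forms_def)
  then show thesis using that[of "(a, b, c)" t] by (simp add: P abc)
qed

section \<open>Commuting matrices\<close>

lemma vec2_eq_iff:
  "(M :: 'a^2^2) = N \<longleftrightarrow> M$1$1 = N$1$1 \<and> M$1$2 = N$1$2 \<and> M$2$1 = N$2$1 \<and> M$2$2 = N$2$2"
  by (auto simp: vec_eq_iff forall_2)

lemma invertible_2_iff: "invertible M \<longleftrightarrow> det M dvd 1" for M :: "'a::comm_ring_1^2^2"
proof
  assume "invertible M"
  then obtain N where "M ** N = mat 1" by (auto simp: invertible_def)
  then show "det M dvd 1" by (metis det_I det_mul dvd_triv_left)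
next
  assume "det M dvd 1"
  then obtain e where e: "(M$1$1 * M$2$2 - M$1$2 * M$2$1) * e = 1"
    by (auto simp: det_2 elim: dvdE)
  define N :: "'a^2^2" where
    "N = vector [vector [e * M$2$2, - e * M$1$2], vector [- e * M$2$1, e * M$1$1]]"
  have "M ** N = mat 1 \<and> N ** M = mat 1"
    using e by (simp add: N_def vec2_eq_iff matrix_matrix_mult_def sum_2 mat_def algebra_simps)
  then show "invertible M" by (auto simp: invertible_def)
qed

definition matrix_form :: "'a::ab_group_add^2^2 \<Rightarrow> 'a \<times> 'a \<times> 'a" where
  "matrix_form M = (M$2$1, M$2$2 - M$1$1, - M$1$2)"

fun companion :: "'a::ab_group_add \<times> 'a \<times> 'a \<Rightarrow> 'a^2^2" where
  "companion (a, b, c) = vector [vector [0, - c], vector [a, b]]"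

lemma matrix_form_companion [simp]: "matrix_form (companion Q) = Q"
  by (cases Q) (simp add: matrix_form_def)

lemma matrix_form_add_mat [simp]:
  fixes M :: "'a::ring_1^2^2"
  shows "matrix_form (M + mat k) = matrix_form M"
  by (simp add: matrix_form_def mat_def)

lemma commute_iff_proportional:
  fixes M N :: "'a::comm_ring_1^2^2"
  shows "M ** N = N ** M \<longleftrightarrow> proportional (matrix_form M) (matrix_form N)"
  by (auto simp: vec2_eq_iff matrix_form_def matrix_matrix_mult_def sum_2 algebra_simps)

lemma commute_map_matrix_of_int_iff:
  fixes M N :: "int^2^2"
  defines "of_int_matrix \<equiv> map_matrix (of_int :: int \<Rightarrow> 'a::{comm_ring_1,ring_char_0})"
  shows "of_int_matrix M ** of_int_matrix N = of_int_matrix N ** of_int_matrix M \<longleftrightarrow>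
    M ** N = N ** M"
  unfolding of_int_matrix_def commute_iff_proportional
  by (simp only: matrix_form_def proportional.simps nth_map_matrix of_int_eq_iff
      flip: of_int_diff of_int_mult of_int_minus)

lemma four_det_eq_trace_discr: "4 * det M = (trace M)\<^sup>2 - form_discr (matrix_form M)"
  by (simp add: matrix_form_def det_2 trace_def sum_2 power2_eq_square algebra_simps)

lemma matrix_with_form_and_trace:
  assumes "even (u\<^sup>2 - form_discr Q)"
  obtains M where "matrix_form M = Q" "trace M = u"
proof -
  obtain a b c where Q: "Q = (a, b, c)" by (cases Q)
  have "even (u - b)" using assms by (simp add: Q)
  then obtain p where p: "u - b = 2 * p" ..
  have "trace (companion Q + mat p) = u" using p by (simp add: Q trace_def sum_2 mat_def)
  then show thesis using that[of "companion Q + mat p"] by simp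
qed

definition symplectic_matrix :: "real^2^2" where
  "symplectic_matrix = vector [vector [0, 1], vector [-1, 0]]"

lemma symplectic_matrix_congruence:
  "transpose M ** symplectic_matrix ** M = det M *\<^sub>R symplectic_matrix"
  unfolding vec2_eq_iff det_2
  by (simp add: symplectic_matrix_def matrix_matrix_mult_def sum_2 transpose_def)

lemma twisted_congruence_iff_commute:
  fixes M B :: "real^2^2"
  assumes "(det M)\<^sup>2 = 1"
  shows "det M *\<^sub>R (transpose M ** (symplectic_matrix ** B) ** M) = symplectic_matrix ** B
    \<longleftrightarrow> M ** B = B ** M"
proof -
  let ?J = symplectic_matrix
  define P where "P = det M *\<^sub>R (transpose M ** ?J)"
  have P_mult_M: "P ** M = ?J"
    using assms
    by (simp add: P_def symplectic_matrix_congruence power2_eq_square flip: scalar_matrix_assoc)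
  have "?J ** (- ?J) = mat 1"
    by (simp add: symplectic_matrix_def vec2_eq_iff matrix_matrix_mult_def sum_2 mat_def)
  then have "P ** (M ** (- ?J)) = mat 1" by (simp add: matrix_mul_assoc P_mult_M)
  then have left_inverse: "M ** (- ?J) ** P = mat 1" by (simp add: matrix_left_right_inverse)
  have cancel: "X = Y" if "P ** X = P ** Y" for X Y :: "real^2^2"
  proof -
    have "M ** (- ?J) ** (P ** X) = M ** (- ?J) ** (P ** Y)" using that by simp
    then show ?thesis by (simp only: matrix_mul_assoc left_inverse matrix_mul_lid)
  qed
  have "det M *\<^sub>R (transpose M ** (?J ** B) ** M) = P ** (B ** M)"
    by (simp add: P_def matrix_mul_assoc flip: scalar_matrix_assoc)
  moreover have "?J ** B = P ** (M ** B)" by (simp add: matrix_mul_assoc P_mult_M)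
  ultimately show ?thesis using cancel[of "B ** M" "M ** B"] by auto
qed

lemma form_matrix_eq_symplectic_matrix_mult:
  "form_matrix (a, b, c) =
    symplectic_matrix ** (map_matrix real_of_int (companion (a, b, c)) + mat (- of_int b / 2))"
  by (simp add: symplectic_matrix_def vec2_eq_iff matrix_matrix_mult_def sum_2 mat_def)

section \<open>Maximal abelian subgroups\<close>

lemma (in group) comm_group_subgroup_iff:
  assumes "subgroup H G"
  shows "comm_group (G\<lparr>carrier := H\<rparr>) \<longleftrightarrow> (\<forall>x\<in>H. \<forall>y\<in>H. x \<otimes> y = y \<otimes> x)"
proof
  assume "comm_group (G\<lparr>carrier := H\<rparr>)"
  then interpret comm_group "G\<lparr>carrier := H\<rparr>" .
  show "\<forall>x\<in>H. \<forall>y\<in>H. x \<otimes> y = y \<otimes> x" using m_comm by simp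
next
  assume "\<forall>x\<in>H. \<forall>y\<in>H. x \<otimes> y = y \<otimes> x"
  then show "comm_group (G\<lparr>carrier := H\<rparr>)"
    using subgroup.subgroup_is_group[OF assms group_axioms]
    by (intro group.group_comm_groupI) auto
qed

lemma (in group) maximal_abelian_subgroupI:
  assumes H: "subgroup H G" and comm: "\<And>x y. x \<in> H \<Longrightarrow> y \<in> H \<Longrightarrow> x \<otimes> y = y \<otimes> x"
    and h: "h \<in> H" and centralizer: "\<And>x. x \<in> carrier G \<Longrightarrow> x \<otimes> h = h \<otimes> x \<Longrightarrow> x \<in> H"
  shows "maximal_abelian_subgroup H G"
  unfolding maximal_abelian_subgroup_def
proof (intro conjI allI impI)
  show "comm_group (G\<lparr>carrier := H\<rparr>)" using comm comm_group_subgroup_iff[OF H] by blast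
  fix K assume K: "subgroup K G \<and> comm_group (G\<lparr>carrier := K\<rparr>) \<and> H \<subseteq> K"
  then have "x \<in> H" if "x \<in> K" for x
    using that h centralizer comm_group_subgroup_iff[of K] subgroup.subset by blast
  with K show "K = H" by blast
qed (rule H)

section \<open>The groups \<open>\<S>(Q)\<close>\<close>

lemma GL2Z_simps [simp]:
  "carrier GL2Z = {M. invertible M}" "M \<otimes>\<^bsub>GL2Z\<^esub> N = M ** N" "\<one>\<^bsub>GL2Z\<^esub> = mat 1"
  by (simp_all add: GL2Z_def)

lemma mem_S_group_iff_commute:
  "M \<in> S_group Q \<longleftrightarrow> invertible M \<and> M ** companion Q = companion Q ** M"
proof -
  obtain a b c where Q: "Q = (a, b, c)" by (cases Q)
  let ?M = "map_matrix real_of_int M"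
  let ?A = "map_matrix real_of_int (companion Q)"
  let ?B = "?A + mat (- of_int b / 2)"
  have "real_of_int (det M) *\<^sub>R (transpose ?M ** form_matrix Q ** ?M) = form_matrix Q \<longleftrightarrow>
      M ** companion Q = companion Q ** M" if "invertible M"
  proof -
    have det: "det ?M = real_of_int (det M)" by (simp add: det_2)
    moreover have "\<bar>det M\<bar> = 1" using that by (simp add: invertible_2_iff)
    ultimately have "(det ?M)\<^sup>2 = 1" by (metis of_int_1 of_int_power one_power2 power2_abs)
    then have "real_of_int (det M) *\<^sub>R (transpose ?M ** form_matrix Q ** ?M) = form_matrix Q \<longleftrightarrow>
        ?M ** ?B = ?B ** ?M"
      using twisted_congruence_iff_commute[of ?M ?B]
      by (simp only: det Q form_matrix_eq_symplectic_matrix_mult)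
    also have "\<dots> \<longleftrightarrow> ?M ** ?A = ?A ** ?M"
      by (simp only: commute_iff_proportional matrix_form_add_mat)
    also have "\<dots> \<longleftrightarrow> M ** companion Q = companion Q ** M" by (rule commute_map_matrix_of_int_iff)
    finally show ?thesis .
  qed
  then show ?thesis by (auto simp: S_group_def)
qed

lemma mem_S_group_iff: "M \<in> S_group Q \<longleftrightarrow> invertible M \<and> proportional (matrix_form M) Q"
  by (simp add: mem_S_group_iff_commute commute_iff_proportional)

lemma subgroup_S_group: "subgroup (S_group Q) GL2Z"
proof -
  interpret group GL2Z by (rule group_GL2Z)
  let ?A = "companion Q"
  show ?thesis
  proof (rule subgroupI)
    show "S_group Q \<subseteq> carrier GL2Z" by (auto simp: mem_S_group_iff)
    have "mat 1 \<in> S_group Q" by (auto simp: mem_S_group_iff_commute invertible_def)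
    then show "S_group Q \<noteq> {}" by blast
  next
    fix M assume M: "M \<in> S_group Q"
    define N where "N = inv\<^bsub>GL2Z\<^esub> M"
    have "M \<in> carrier GL2Z" using M by (simp add: mem_S_group_iff)
    then have N: "invertible N" "N ** M = mat 1" "M ** N = mat 1"
      using inv_closed[of M] l_inv[of M] r_inv[of M] by (simp_all add: N_def)
    have "N ** ?A = N ** (?A ** M) ** N" by (simp add: N flip: matrix_mul_assoc)
    also have "?A ** M = M ** ?A" using M by (simp add: mem_S_group_iff_commute)
    also have "N ** (M ** ?A) ** N = ?A ** N" by (simp add: N matrix_mul_assoc)
    finally show "inv\<^bsub>GL2Z\<^esub> M \<in> S_group Q" using N(1) by (simp add: mem_S_group_iff_commute N_def)
  next
    fix M N assume "M \<in> S_group Q" "N \<in> S_group Q"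
    then have M: "invertible M" "M ** ?A = ?A ** M" and N: "invertible N" "N ** ?A = ?A ** N"
      by (simp_all add: mem_S_group_iff_commute)
    have "M ** N ** ?A = M ** ?A ** N" by (simp add: N(2) flip: matrix_mul_assoc)
    also have "\<dots> = ?A ** (M ** N)" by (simp add: M(2) matrix_mul_assoc)
    finally show "M \<otimes>\<^bsub>GL2Z\<^esub> N \<in> S_group Q"
      using M(1) N(1) by (simp add: mem_S_group_iff_commute invertible_mult)
  qed
qed

lemma S_group_commute:
  assumes "Q \<noteq> (0, 0, 0)" "M \<in> S_group Q" "N \<in> S_group Q"
  shows "M ** N = N ** M"
  using assms proportional_trans[OF _ proportional_sym, of "matrix_form M" Q "matrix_form N"]
  by (simp add: mem_S_group_iff commute_iff_proportional)

lemma maximal_abelian_S_group_if_nonscalar: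
  assumes Q: "Q \<noteq> (0, 0, 0)" and M: "M \<in> S_group Q" "matrix_form M \<noteq> (0, 0, 0)"
  shows "maximal_abelian_subgroup (S_group Q) GL2Z"
proof (rule group.maximal_abelian_subgroupI[OF group_GL2Z subgroup_S_group _ M(1)])
  fix N assume "N \<in> carrier GL2Z" "N \<otimes>\<^bsub>GL2Z\<^esub> M = M \<otimes>\<^bsub>GL2Z\<^esub> N"
  then show "N \<in> S_group Q"
    using M proportional_trans[of "matrix_form N" "matrix_form M" Q]
    by (simp add: mem_S_group_iff commute_iff_proportional)
qed (simp add: S_group_commute[OF Q])

lemma S_group_nonscalar_iff:
  assumes "Q \<in> forms"
  shows "(\<exists>M\<in>S_group Q. matrix_form M \<noteq> (0, 0, 0)) \<longleftrightarrow> pell_four_nontrivial (form_discr Q)"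
proof
  assume "\<exists>M\<in>S_group Q. matrix_form M \<noteq> (0, 0, 0)"
  then obtain M where M: "invertible M" "proportional (matrix_form M) Q"
    and nonscalar: "matrix_form M \<noteq> (0, 0, 0)"
    by (auto simp: mem_S_group_iff)
  obtain t where t: "matrix_form M = scale_form t Q"
    using assms M(2) by (rule proportional_to_primitive)
  have "t \<noteq> 0" using nonscalar t by (cases Q) auto
  moreover have "\<bar>4 * det M\<bar> = 4" using M(1) by (simp add: invertible_2_iff abs_mult)
  then have "\<bar>(trace M)\<^sup>2 - form_discr Q * t\<^sup>2\<bar> = 4"
    by (simp only: four_det_eq_trace_discr t form_discr_scale_form)
  ultimately show "pell_four_nontrivial (form_discr Q)"
    unfolding pell_four_nontrivial_def by blast
next
  assume "pell_four_nontrivial (form_discr Q)"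
  then obtain u t where t: "t \<noteq> 0" and ut: "\<bar>u\<^sup>2 - form_discr (scale_form t Q)\<bar> = 4"
    by (auto simp: pell_four_nontrivial_def form_discr_scale_form)
  have "even (u\<^sup>2 - form_discr (scale_form t Q))" using ut by (metis dvd_abs_iff even_numeral)
  then obtain M where M: "matrix_form M = scale_form t Q" "trace M = u"
    by (rule matrix_with_form_and_trace)
  have "\<bar>4 * det M\<bar> = 4" using ut by (simp only: four_det_eq_trace_discr M)
  then have "invertible M" by (simp add: invertible_2_iff abs_mult)
  then have "M \<in> S_group Q" by (simp add: mem_S_group_iff M(1) proportional_scale_form)
  moreover have "matrix_form M \<noteq> (0, 0, 0)"
    using t assms unfolding M(1) by (cases Q) (auto simp: forms_def)
  ultimately show "\<exists>M\<in>S_group Q. matrix_form M \<noteq> (0, 0, 0)" by blast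
qed

lemma F_plus_Un_F_minus_iff_nonscalar:
  "Q \<in> F_plus \<union> F_minus \<longleftrightarrow> Q \<in> forms \<and> (\<exists>M\<in>S_group Q. matrix_form M \<noteq> (0, 0, 0))"
  using F_plus_Un_F_minus_iff[of Q] S_group_nonscalar_iff[of Q] by argo

lemma maximal_abelian_S_group:
  assumes "Q \<in> F_plus \<union> F_minus"
  shows "maximal_abelian_subgroup (S_group Q) GL2Z"
proof -
  have "Q \<in> forms" using assms F_plus_Un_F_minus_iff_nonscalar by blast
  then have "Q \<noteq> (0, 0, 0)" by auto
  moreover obtain M where "M \<in> S_group Q" "matrix_form M \<noteq> (0, 0, 0)"
    using assms F_plus_Un_F_minus_iff_nonscalar by blast
  ultimately show ?thesis by (rule maximal_abelian_S_group_if_nonscalar)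
qed

lemma commuting_subset_S_group:
  assumes inv: "\<And>M. M \<in> H \<Longrightarrow> invertible M"
    and comm: "\<And>M N. M \<in> H \<Longrightarrow> N \<in> H \<Longrightarrow> M ** N = N ** M"
  shows "\<exists>Q\<in>F_plus \<union> F_minus. H \<subseteq> S_group Q"
proof (cases "\<exists>M\<in>H. matrix_form M \<noteq> (0, 0, 0)")
  case True
  then obtain M where M: "M \<in> H" "matrix_form M \<noteq> (0, 0, 0)" by blast
  obtain t Q where Q: "Q \<in> forms" and form: "matrix_form M = scale_form t Q"
    using primitive_multiple[OF M(2)] .
  have "H \<subseteq> S_group Q"
  proof
    fix N assume "N \<in> H"
    then have "proportional (matrix_form N) (matrix_form M)"
      using comm M(1) commute_iff_proportional by blast
    then have "proportional (matrix_form N) Q"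
      using proportional_trans M(2) proportional_scale_form[of t Q] form by metis
    then show "N \<in> S_group Q" using inv \<open>N \<in> H\<close> by (simp add: mem_S_group_iff)
  qed
  with Q M show ?thesis using F_plus_Un_F_minus_iff_nonscalar by blast
next
  case False
  then have "H \<subseteq> S_group (0, 0, 1)" using inv by (auto simp: mem_S_group_iff)
  moreover have "(0, 0, 1) \<in> F_minus" by (simp add: F_minus_def forms_def)
  ultimately show ?thesis by blast
qed

theorem theorem4p44:
  fixes \<G> :: "(int^2^2) set"
  assumes "subgroup \<G> GL2Z"
  shows "maximal_abelian_subgroup \<G> GL2Z \<longleftrightarrow> (\<exists>Q \<in> F_plus \<union> F_minus. \<G> = S_group Q)"
proof
  assume maximal: "maximal_abelian_subgroup \<G> GL2Z"
  then have "\<forall>M\<in>\<G>. \<forall>N\<in>\<G>. M ** N = N ** M"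
    using group.comm_group_subgroup_iff[OF group_GL2Z assms]
    by (simp add: maximal_abelian_subgroup_def)
  moreover have "\<forall>M\<in>\<G>. invertible M" using subgroup.subset[OF assms] by auto
  ultimately obtain Q where Q: "Q \<in> F_plus \<union> F_minus" "\<G> \<subseteq> S_group Q"
    using commuting_subset_S_group[of \<G>] by blast
  have "maximal_abelian_subgroup (S_group Q) GL2Z" using Q(1) by (rule maximal_abelian_S_group)
  with maximal Q(2) have "S_group Q = \<G>" by (simp add: maximal_abelian_subgroup_def)
  with Q(1) show "\<exists>Q \<in> F_plus \<union> F_minus. \<G> = S_group Q" by blast
next
  assume "\<exists>Q \<in> F_plus \<union> F_minus. \<G> = S_group Q"
  then obtain Q where "Q \<in> F_plus \<union> F_minus" and "\<G> = S_group Q" ..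
  then show "maximal_abelian_subgroup \<G> GL2Z" using maximal_abelian_S_group by simp
qed

end
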